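(* Let $M\in\mathbb{R}^{n\times n}$ be symmetric positive semidefinite, let $E\in\mathbb{R}^{n\times n}$ be such that $M+E$ is symmetric, and let $1\le k<n$. Let $P_\star$ and $\widehat{P}$ denote the orthogonal projectors onto the spaces spanned by the top $k$ eigenvectors of $M$ and of $M+E$, respectively. Suppose that the eigenvalue gap $\gamma=\lambda_k(M)-\lambda_{k+1}(M)$ is positive. Then $$\bigl\|P_\star-\widehat{P}\bigr\|_2\;\le\;\frac{2\,\|E\|_2}{\gamma}.$$
   Context: $\|\cdot\|_2$ is the spectral norm. For a symmetric matrix $N$, $\lambda_1(N)\ge\dots\ge\lambda_n(N)$ are its eigenvalues in decreasing order, and "the top $k$ eigenvectors" means orthonormal eigenvectors associated with $\lambda_1(N),\dots,\lambda_k(N)$. *)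

theory Defs
  imports "HOL-Analysis.Analysis" "HOL-Computational_Algebra.Polynomial"
begin

definition symmetric_mat :: "real^'n^'n \<Rightarrow> bool" where
  "symmetric_mat N \<longleftrightarrow> transpose N = N"

definition pos_semidef :: "real^'n^'n \<Rightarrow> bool" where
  "pos_semidef N \<longleftrightarrow> symmetric_mat N \<and> (\<forall>x. 0 \<le> x \<bullet> (N *v x))"

text \<open>The norm that the library puts on matrices is the Frobenius norm, so the spectral norm has
  to be taken as the operator norm of the induced linear map on Euclidean space.\<close>

definition spectral_norm :: "real^'n^'n \<Rightarrow> real" where
  "spectral_norm A = onorm (\<lambda>x. A *v x)"

definition charpoly :: "real^'n^'n \<Rightarrow> real poly" where
  "charpoly N = det (mat [:0, 1:] - (\<chi> i j. [:N $ i $ j:]))"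

text \<open>The index \<open>i\<close> counts from 1, and eigenvalues are repeated according to their multiplicity as
  roots of the characteristic polynomial. Only real roots are collected; for symmetric \<open>N\<close> these
  are all the roots, and \<open>eigval N i\<close> is then meaningful for \<open>1 \<le> i \<le> n\<close>.\<close>

definition eigval :: "real^'n^'n \<Rightarrow> nat \<Rightarrow> real" where
  "eigval N i = rev (sorted_list_of_multiset (proots (charpoly N))) ! (i - 1)"

definition top_eigenvectors :: "real^'n^'n \<Rightarrow> nat \<Rightarrow> (nat \<Rightarrow> real^'n) \<Rightarrow> bool" where
  "top_eigenvectors N k u \<longleftrightarrow>
     (\<forall>i\<in>{1..k}. \<forall>j\<in>{1..k}. u i \<bullet> u j = (if i = j then 1 else 0)) \<and>
     (\<forall>i\<in>{1..k}. N *v u i = eigval N i *\<^sub>R u i)"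

definition orthogonal_projector :: "real^'n^'n \<Rightarrow> (real^'n) set \<Rightarrow> bool" where
  "orthogonal_projector P S \<longleftrightarrow> (\<forall>x. P *v x \<in> S \<and> x - P *v x \<in> S\<^sup>\<bottom>)"

end

(* Symmetric matrices are diagonalised by maximising the Rayleigh quotient on invariant subspaces,
   which identifies the sorted roots of the characteristic polynomial with the eigenvalues of an
   orthonormal eigenbasis. If the norm of E is at least gamma / 2, the bound is trivial, since
   projectors differ by at most 1 in norm. Otherwise Weyl's inequality leaves a gap of at least
   gamma / 2 between the top k eigenvalues of either matrix and the remaining ones of the other.
   For unit vectors p in the top eigenspace of A and q in the orthogonal complement of that of B
   that maximise s = <p, q>, p and q project onto each other up to the factor s, so
   <q, (A - B) p> = s (<p, A p> - <q, B q>), which bounds s by the norm of E over that gap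
   (the sin theta theorem). *)

theory Submission
  imports Defs
begin

section \<open>Orthonormal eigenbases of symmetric matrices\<close>

text \<open>The eigenvalues \<open>d\<close> are left free and unordered, so that a full eigenbasis
  can be built before its eigenvalues are matched with the sorted roots in
  \<open>eigval\<close>.\<close>

definition orthonormal_eigvecs ::
    "real^'n^'n \<Rightarrow> nat \<Rightarrow> (nat \<Rightarrow> real) \<Rightarrow> (nat \<Rightarrow> real^'n) \<Rightarrow> bool" where
  "orthonormal_eigvecs N k d u \<longleftrightarrow>
     (\<forall>i\<in>{1..k}. \<forall>j\<in>{1..k}. u i \<bullet> u j = (if i = j then 1 else 0)) \<and>
     (\<forall>i\<in>{1..k}. N *v u i = d i *\<^sub>R u i)"

lemma top_eigenvectors_iff:
  "top_eigenvectors N k u \<longleftrightarrow> orthonormal_eigvecs N k (eigval N) u"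
  by (simp add: top_eigenvectors_def orthonormal_eigvecs_def)

lemma symmetric_mat_inner:
  assumes "symmetric_mat N"
  shows "(N *v x) \<bullet> y = x \<bullet> (N *v y)"
  using assms unfolding symmetric_mat_def
  by (metis dot_lmul_matrix transpose_matrix_vector)

text \<open>The Rayleigh quotient attains its maximum \<open>m\<close> on the compact unit sphere of
  \<open>S\<close>, at \<open>x\<close> say. By invariance the residual \<open>r = N x - m x\<close>
  is itself an admissible direction in \<open>S\<close>, and optimality in that direction forces
  \<open>r = 0\<close>.\<close>

lemma symmetric_mat_eigenvector_exists:
  fixes N :: "real^'n^'n"
  assumes sym: "symmetric_mat N" and S: "subspace S" and z: "z \<in> S" "z \<noteq> 0"
    and inv: "\<And>x. x \<in> S \<Longrightarrow> N *v x \<in> S"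
  shows "\<exists>x\<in>S. \<exists>m. norm x = 1 \<and> N *v x = m *\<^sub>R x"
proof -
  let ?q = "\<lambda>x. x \<bullet> (N *v x)"
  let ?K = "S \<inter> sphere 0 1"
  have "compact ?K"
    using closed_subspace[OF S] by (simp add: closed_Int_compact)
  moreover have "(1 / norm z) *\<^sub>R z \<in> ?K"
    using z S by (auto simp: subspace_scale)
  moreover have "continuous_on ?K ?q"
    by (intro continuous_intros linear_continuous_on_compose matrix_vector_mul_linear)
  ultimately obtain x where x: "x \<in> ?K" and xmax: "\<And>y. y \<in> ?K \<Longrightarrow> ?q y \<le> ?q x"
    using continuous_attains_sup[of ?K ?q] by blast
  define m where "m = ?q x"
  have xS: "x \<in> S" and nx: "x \<bullet> x = 1" using x by (auto simp: norm_eq_1)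
  have qle: "?q y \<le> m * (y \<bullet> y)" if y: "y \<in> S" for y
  proof (cases "y = 0")
    case False
    then have "(1 / norm y) *\<^sub>R y \<in> ?K" using y S by (auto simp: subspace_scale)
    from xmax[OF this] have "?q y / (norm y)\<^sup>2 \<le> m"
      by (simp add: m_def matrix_vector_mult_scaleR power2_eq_square)
    with False show ?thesis by (simp add: divide_le_eq power2_norm_eq_inner)
  qed simp
  define r where "r = N *v x - m *\<^sub>R x"
  have rS: "r \<in> S" unfolding r_def using xS inv S by (intro subspace_diff subspace_scale) auto
  define K where "K = m * (r \<bullet> r) - ?q r"
  have K0: "K \<ge> 0" using qle[OF rS] by (simp add: K_def)
  \<comment> \<open>First variation of the Rayleigh quotient at its maximum \<open>x\<close> in the direction \<open>r\<close>.\<close>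
  have var: "2 * t * (r \<bullet> r) \<le> t\<^sup>2 * K" for t
  proof -
    have "x + t *\<^sub>R r \<in> S" using xS rS S by (intro subspace_add subspace_scale)
    from qle[OF this]
    have "m + t * (x \<bullet> (N *v r)) + t * (r \<bullet> (N *v x)) + t\<^sup>2 * ?q r
        \<le> m * (1 + 2 * t * (r \<bullet> x) + t\<^sup>2 * (r \<bullet> r))"
      using nx by (simp add: m_def matrix_vector_mult_scaleR matrix_vector_right_distrib algebra_simps
          inner_add_left inner_add_right inner_commute power2_eq_square)
    moreover have "x \<bullet> (N *v r) = r \<bullet> (N *v x)"
      using symmetric_mat_inner[OF sym, of x r] by (simp add: inner_commute)
    moreover have "r \<bullet> (N *v x) = r \<bullet> r + m * (r \<bullet> x)"
      by (subst (3) r_def) (simp add: inner_diff_right)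
    ultimately show ?thesis by (simp add: K_def algebra_simps)
  qed
  have "r \<bullet> r = 0"
  proof (rule ccontr)
    assume "r \<bullet> r \<noteq> 0"
    then have pos: "r \<bullet> r > 0" by simp
    \<comment> \<open>A step short enough for the linear term to beat the quadratic one:
      \<open>t * K\<close> stays below \<open>r \<bullet> r\<close>. Adding 1 keeps the denominator
      positive when \<open>K = 0\<close>.\<close>
    let ?t = "(r \<bullet> r) / (K + 1)"
    have t: "?t > 0" using pos K0 by simp
    have "?t * (2 * (r \<bullet> r)) \<le> ?t * (?t * K)"
      using var[of ?t] by (simp only: power2_eq_square ac_simps)
    then have "2 * (r \<bullet> r) \<le> ?t * K" using t by (simp only: mult_le_cancel_left_pos)
    also have "\<dots> < 2 * (r \<bullet> r)" using pos K0 by (simp add: divide_less_eq)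
    finally show False by simp
  qed
  then have "N *v x = m *\<^sub>R x" by (simp add: r_def)
  then show ?thesis using x by auto
qed

text \<open>Symmetry makes the orthogonal complement of the given eigenvectors invariant, and
  \<open>k < CARD('n)\<close> makes it nonzero, so it contains a further unit eigenvector.\<close>

lemma orthonormal_eigvecs_Suc:
  fixes N :: "real^'n^'n"
  assumes sym: "symmetric_mat N" and u: "orthonormal_eigvecs N k d u" and k: "k < CARD('n)"
  shows "\<exists>m w. orthonormal_eigvecs N (Suc k) (d(Suc k := m)) (u(Suc k := w))"
proof -
  let ?S = "{x. \<forall>i\<in>{1..k}. u i \<bullet> x = 0}"
  have S: "subspace ?S" by (auto simp: subspace_def inner_add_right)
  have "dim (u ` {1..k}) \<le> card (u ` {1..k})" by (simp add: dim_le_card')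
  also have "\<dots> \<le> k" using card_image_le[of "{1..k}" u] by simp
  finally have "dim (u ` {1..k}) < DIM(real^'n)" using k by simp
  from orthogonal_to_subspace_exists[OF this] obtain z
    where z: "z \<noteq> 0" "\<And>y. y \<in> span (u ` {1..k}) \<Longrightarrow> orthogonal z y" by blast
  have "orthogonal z (u i)" if "i \<in> {1..k}" for i
    using that by (intro z(2) span_base) auto
  then have zS: "z \<in> ?S" by (auto simp: orthogonal_def inner_commute)
  have "N *v x \<in> ?S" if "x \<in> ?S" for x
    using that u by (auto simp flip: symmetric_mat_inner[OF sym] simp: orthonormal_eigvecs_def)
  from symmetric_mat_eigenvector_exists[OF sym S zS z(1) this]
  obtain w m where "w \<in> ?S" "norm w = 1" "N *v w = m *\<^sub>R w" by blast
  then have "orthonormal_eigvecs N (Suc k) (d(Suc k := m)) (u(Suc k := w))"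
    using u by (auto simp: orthonormal_eigvecs_def atLeastAtMostSuc_conv norm_eq_1 inner_commute)
  then show ?thesis by blast
qed

lemma orthonormal_eigvecs_extend:
  fixes N :: "real^'n^'n"
  assumes sym: "symmetric_mat N" and u: "orthonormal_eigvecs N k d u" and k: "k \<le> CARD('n)"
  shows "\<exists>d' u'. orthonormal_eigvecs N CARD('n) d' u' \<and> (\<forall>i\<in>{1..k}. d' i = d i \<and> u' i = u i)"
  using k u
\<comment> \<open>The induction runs downwards from \<open>CARD('n)\<close> to \<open>k\<close>;
  each step applies the hypothesis to the family enlarged by one vector, hence the generalisation
  over \<open>d\<close> and \<open>u\<close>.\<close>
proof (induction arbitrary: d u rule: inc_induct)
  case base
  then show ?case by blast
next
  case (step k)
  from orthonormal_eigvecs_Suc[OF sym step.prems step.hyps(2)] obtain m w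
    where "orthonormal_eigvecs N (Suc k) (d(Suc k := m)) (u(Suc k := w))" by blast
  from step.IH[OF this] obtain d' u' where
    *: "orthonormal_eigvecs N CARD('n) d' u'"
    "\<forall>i\<in>{1..Suc k}. d' i = (d(Suc k := m)) i \<and> u' i = (u(Suc k := w)) i" by blast
  then have "\<forall>i\<in>{1..k}. d' i = d i \<and> u' i = u i" by auto
  with *(1) show ?case by blast
qed

section \<open>Spans of eigenvectors and expansions in them\<close>

lemma orthonormal_eigvecs_inj:
  assumes "orthonormal_eigvecs N k d u"
  shows "inj_on u {1..k}"
  using assms unfolding orthonormal_eigvecs_def inj_on_def
  by (metis zero_neq_one)

lemma orthonormal_eigvecs_independent:
  assumes "orthonormal_eigvecs N k d u"
  shows "independent (u ` {1..k})"
proof (rule pairwise_orthogonal_independent)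
  show "pairwise orthogonal (u ` {1..k})"
    using assms unfolding orthonormal_eigvecs_def pairwise_def orthogonal_def by force
  show "0 \<notin> u ` {1..k}"
    using assms unfolding orthonormal_eigvecs_def
    by (metis imageE inner_zero_left zero_neq_one)
qed

lemma orthonormal_eigvecs_dim:
  assumes "orthonormal_eigvecs N k d u"
  shows "dim (span (u ` {1..k})) = k"
  using orthonormal_eigvecs_independent[OF assms] orthonormal_eigvecs_inj[OF assms]
  by (simp add: dim_eq_card_independent card_image)

lemma orthonormal_eigvecs_span_invariant:
  assumes u: "orthonormal_eigvecs N k d u" and x: "x \<in> span (u ` {1..k})"
  shows "N *v x \<in> span (u ` {1..k})"
  using x
proof (induction rule: span_induct_alt)
  case base
  then show ?case by (simp add: span_zero)
next
  case (step c x y)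
  then have "N *v x \<in> span (u ` {1..k})"
    using u by (auto simp: orthonormal_eigvecs_def span_base span_scale)
  with step show ?case
    by (simp add: matrix_vector_right_distrib matrix_vector_mult_scaleR span_add span_scale)
qed

lemma symmetric_mat_orthogonal_comp_invariant:
  assumes sym: "symmetric_mat N" and inv: "\<And>x. x \<in> S \<Longrightarrow> N *v x \<in> S" and x: "x \<in> S\<^sup>\<bottom>"
  shows "N *v x \<in> S\<^sup>\<bottom>"
  using x inv
  by (auto simp: orthogonal_comp_def orthogonal_def simp flip: symmetric_mat_inner[OF sym])

lemma orthonormal_eigvecs_expand:
  fixes x :: "real^'n"
  assumes u: "orthonormal_eigvecs N k d u" and x: "x \<in> span (u ` {1..k})"
  shows "x = (\<Sum>i\<in>{1..k}. (x \<bullet> u i) *\<^sub>R u i)"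
proof -
  have "(\<Sum>b\<in>u ` {1..k}. (x \<bullet> b) *\<^sub>R b) = x"
  proof (rule orthonormal_basis_expand)
    show "pairwise orthogonal (u ` {1..k})"
      using u unfolding orthonormal_eigvecs_def pairwise_def orthogonal_def by force
  qed (use u x in \<open>auto simp: orthonormal_eigvecs_def norm_eq_1\<close>)
  then show ?thesis
    unfolding sum.reindex[OF orthonormal_eigvecs_inj[OF u]] o_def by (rule sym)
qed

text \<open>Diagonal form and Parseval's identity: bounds on the \<open>d i\<close> turn into bounds
  on the quadratic form by comparing the two sums termwise.\<close>

lemma orthonormal_eigvecs_quadratic_form:
  fixes x :: "real^'n"
  assumes u: "orthonormal_eigvecs N k d u" and x: "x \<in> span (u ` {1..k})"
  shows "x \<bullet> (N *v x) = (\<Sum>i\<in>{1..k}. d i * (x \<bullet> u i)\<^sup>2)"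
    and "x \<bullet> x = (\<Sum>i\<in>{1..k}. (x \<bullet> u i)\<^sup>2)"
proof -
  note ex = orthonormal_eigvecs_expand[OF u x]
  have "N *v x = (\<Sum>i\<in>{1..k}. (x \<bullet> u i) *\<^sub>R (N *v u i))"
    by (subst ex) (simp add: linear_sum[OF matrix_vector_mul_linear] matrix_vector_mult_scaleR)
  also have "\<dots> = (\<Sum>i\<in>{1..k}. (d i * (x \<bullet> u i)) *\<^sub>R u i)"
    using u by (intro sum.cong) (auto simp: orthonormal_eigvecs_def)
  finally show "x \<bullet> (N *v x) = (\<Sum>i\<in>{1..k}. d i * (x \<bullet> u i)\<^sup>2)"
    by (simp add: inner_sum_right power2_eq_square mult.assoc)
  show "x \<bullet> x = (\<Sum>i\<in>{1..k}. (x \<bullet> u i)\<^sup>2)"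
    by (subst (2) ex) (simp add: inner_sum_right power2_eq_square)
qed

lemma orthonormal_eigvecs_span_UNIV:
  fixes N :: "real^'n^'n"
  assumes "orthonormal_eigvecs N CARD('n) d u"
  shows "span (u ` {1..CARD('n)}) = UNIV"
  using orthonormal_eigvecs_dim[OF assms] by (intro dim_eq_full[THEN iffD1, simplified span_span]) simp

section \<open>The characteristic polynomial and its sorted roots\<close>

lemma poly_det:
  fixes A :: "real poly^'n^'n"
  shows "poly (det A) t = det (\<chi> i j. poly (A $ i $ j) t)"
  by (simp add: det_def poly_sum poly_prod)

lemma poly_charpoly: "poly (charpoly N) t = det (mat t - N)"
  unfolding charpoly_def poly_det
  by (rule arg_cong[of _ _ det]) (simp add: vec_eq_iff mat_def)

text \<open>The matrix \<open>Q\<close> with the eigenvectors as columns intertwines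
  \<open>mat t - N\<close> with a diagonal matrix. Comparing determinants at every real
  \<open>t\<close> determines the polynomial.\<close>

lemma charpoly_eq_prod:
  fixes N :: "real^'n^'n"
  assumes u: "orthonormal_eigvecs N CARD('n) d u"
  shows "charpoly N = (\<Prod>i\<in>{1..CARD('n)}. [:- d i, 1:])"
proof -
  \<comment> \<open>The matrix index type carries no numbering, so \<open>f\<close> supplies one
    that assigns an eigenvector to each column.\<close>
  have "\<exists>f. bij_betw f (UNIV :: 'n set) {1..CARD('n)}"
    by (rule finite_same_card_bij) auto
  then obtain f where f: "bij_betw f (UNIV :: 'n set) {1..CARD('n)}" ..
  have fi: "f i \<in> {1..CARD('n)}" for i using f by (auto simp: bij_betw_def)
  have finj: "f i = f j \<longleftrightarrow> i = j" for i j using f by (auto simp: bij_betw_def inj_on_def)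
  let ?Q = "(\<chi> i j. u (f j) $ i) :: real^'n^'n"
  have "transpose ?Q ** ?Q = mat 1"
    using u fi finj unfolding orthonormal_eigvecs_def
    by (simp add: vec_eq_iff matrix_matrix_mult_def transpose_def mat_def inner_vec_def)
  then have "det (transpose ?Q ** ?Q) = 1" by simp
  then have Q0: "det ?Q \<noteq> 0" by (auto simp: det_mul)
  have "poly (charpoly N) t = (\<Prod>i\<in>{1..CARD('n)}. t - d i)" for t
  proof -
    let ?D = "(\<chi> i j. if i = j then t - d (f i) else 0) :: real^'n^'n"
    have "(mat t - N) ** ?Q = ?Q ** ?D"
    proof -
      have "(N *v u (f j)) $ i = d (f j) * u (f j) $ i" for i j
        using u fi by (simp add: orthonormal_eigvecs_def)
      then show ?thesis
        by (simp add: vec_eq_iff matrix_matrix_mult_def mat_def matrix_vector_mult_def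
            left_diff_distrib sum_subtractf if_distrib[where f="\<lambda>z. z * _"]
            if_distrib[where f="\<lambda>z. _ * z"] algebra_simps cong: if_cong)
    qed
    then have "det (mat t - N) * det ?Q = det ?Q * det ?D"
      unfolding det_mul[symmetric] by (rule arg_cong)
    then have "det (mat t - N) = det ?D" using Q0 by simp
    also have "\<dots> = (\<Prod>i\<in>UNIV. t - d (f i))" by (subst det_diagonal) auto
    also have "\<dots> = (\<Prod>i\<in>{1..CARD('n)}. t - d i)" by (rule prod.reindex_bij_betw[OF f])
    finally show ?thesis by (simp add: poly_charpoly)
  qed
  then show ?thesis by (simp add: poly_eq_poly_eq_iff[symmetric] fun_eq_iff poly_prod)
qed

lemma proots_charpoly:
  fixes N :: "real^'n^'n"
  assumes u: "orthonormal_eigvecs N CARD('n) d u"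
  shows "proots (charpoly N) = image_mset d (mset_set {1..CARD('n)})"
proof -
  have "proots (\<Prod>i\<in>I. [:- d i, 1:]) = image_mset d (mset_set I)" if "finite I" for I
    using that
  proof (induction I)
    case empty
    show ?case by simp
  next
    case (insert j I)
    have "(\<Prod>i\<in>I. [:- d i, 1:]) \<noteq> 0" using insert.hyps(1) by (simp add: prod_zero_iff)
    then have "proots ([:- d j, 1:] * (\<Prod>i\<in>I. [:- d i, 1:]))
        = proots [:- d j, 1:] + proots (\<Prod>i\<in>I. [:- d i, 1:])"
      by (intro proots_mult) auto
    then show ?case using insert by (simp del: mult_pCons_left)
  qed
  then show ?thesis by (simp add: charpoly_eq_prod[OF u])
qed

text \<open>Naming the whole decreasing list allows it to be split by \<open>take\<close> and
  \<open>drop\<close>. Entry \<open>k\<close>, counted from 0, is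
  \<open>eigval N (Suc k)\<close>.\<close>

definition eigval_list :: "real^'n^'n \<Rightarrow> real list" where
  "eigval_list N = rev (sorted_list_of_multiset (proots (charpoly N)))"

lemma eigval_eq: "eigval N i = eigval_list N ! (i - 1)"
  by (simp add: eigval_def eigval_list_def)

lemma length_eigval_list:
  fixes N :: "real^'n^'n"
  assumes sym: "symmetric_mat N"
  shows "length (eigval_list N) = CARD('n)"
proof -
  \<comment> \<open>The empty family, with arbitrary placeholder values, is extended to a full
    eigenbasis; this shows that all \<open>CARD('n)\<close> roots are real.\<close>
  have "orthonormal_eigvecs N 0 (\<lambda>_. 0) (\<lambda>_. 0)" by (simp add: orthonormal_eigvecs_def)
  from orthonormal_eigvecs_extend[OF sym this] obtain d u
    where "orthonormal_eigvecs N CARD('n) d u" by blast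
  from proots_charpoly[OF this] have "size (mset (eigval_list N)) = CARD('n)"
    by (simp add: eigval_list_def)
  then show ?thesis by simp
qed

lemma eigval_antimono:
  fixes N :: "real^'n^'n"
  assumes sym: "symmetric_mat N" and "1 \<le> i" "i \<le> j" "j \<le> CARD('n)"
  shows "eigval N j \<le> eigval N i"
proof -
  have "sorted_wrt (\<ge>) (eigval_list N)"
    by (simp add: eigval_list_def sorted_wrt_rev)
  then show ?thesis
    using assms length_eigval_list[OF sym] by (cases "i = j") (auto simp: eigval_eq sorted_wrt_iff_nth_less)
qed

text \<open>All the \<open>d i\<close> together form the multiset of roots, and the first
  \<open>k\<close> of them form \<open>take k\<close>; cancelling leaves \<open>drop k\<close>.
  Multisets are used because eigenvalues may repeat, also across position \<open>k\<close>.\<close>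

lemma remaining_eigenvalues:
  fixes N :: "real^'n^'n"
  assumes sym: "symmetric_mat N" and u: "orthonormal_eigvecs N CARD('n) d u"
    and k: "k \<le> CARD('n)" and d: "\<And>i. i \<in> {1..k} \<Longrightarrow> d i = eigval N i"
  shows "d ` {k<..CARD('n)} = set (drop k (eigval_list N))"
proof -
  let ?L = "eigval_list N"
  have len: "length ?L = CARD('n)" by (rule length_eigval_list[OF sym])
  have "image_mset d (mset_set {1..k}) = image_mset (\<lambda>i. ?L ! (i - 1)) (mset_set {1..k})"
    using d by (intro image_mset_cong) (simp add: eigval_eq)
  also have "\<dots> = mset (map (\<lambda>i. ?L ! (i - 1)) [1..<Suc k])"
    by (simp add: atLeastLessThanSuc_atLeastAtMost del: upt_Suc)
  also have "map (\<lambda>i. ?L ! (i - 1)) [1..<Suc k] = take k ?L"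
    using k len by (intro nth_equalityI) (auto simp del: upt_Suc)
  finally have top: "image_mset d (mset_set {1..k}) = mset (take k ?L)" .
  have split: "{1..CARD('n)} = {1..k} \<union> {k<..CARD('n)}" using k by auto
  have "image_mset d (mset_set {1..CARD('n)})
      = image_mset d (mset_set {1..k}) + image_mset d (mset_set {k<..CARD('n)})"
    unfolding split by (subst mset_set_Union) auto
  moreover have "image_mset d (mset_set {1..CARD('n)}) = mset (take k ?L) + mset (drop k ?L)"
    using proots_charpoly[OF u]
    by (metis append_take_drop_id eigval_list_def mset_append mset_rev mset_sorted_list_of_multiset)
  ultimately have "image_mset d (mset_set {k<..CARD('n)}) = mset (drop k ?L)"
    using top by simp
  from arg_cong[OF this, of set_mset] show ?thesis by simp
qed

section \<open>Top eigenvectors and bounds on the quadratic form\<close>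

text \<open>Any choice of top eigenvectors extends to an eigenbasis whose remaining eigenvalues are
  the tail of the sorted list. The head of that tail bounds the quadratic form on the complement,
  and it also occurs as an eigenvalue of some basis vector, which serves as
  \<open>w\<close>.\<close>

lemma top_eigenvectors_complement:
  fixes N :: "real^'n^'n"
  assumes sym: "symmetric_mat N" and u: "top_eigenvectors N k u" and k: "k < CARD('n)"
  shows "x \<in> (span (u ` {1..k}))\<^sup>\<bottom> \<Longrightarrow> x \<bullet> (N *v x) \<le> eigval N (Suc k) * (x \<bullet> x)"
    and "\<exists>w. top_eigenvectors N (Suc k) (u(Suc k := w))"
proof -
  from orthonormal_eigvecs_extend[OF sym u[unfolded top_eigenvectors_iff]] k
  obtain d u' where u': "orthonormal_eigvecs N CARD('n) d u'"
    and eq: "\<And>i. i \<in> {1..k} \<Longrightarrow> d i = eigval N i" "\<And>i. i \<in> {1..k} \<Longrightarrow> u' i = u i"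
    by (metis less_imp_le)
  let ?L = "eigval_list N"
  have len: "length ?L = CARD('n)" by (rule length_eigval_list[OF sym])
  have rest: "d ` {k<..CARD('n)} = set (drop k ?L)"
    using remaining_eigenvalues[OF sym u' _ eq(1)] k by simp
  have le: "d i \<le> eigval N (Suc k)" if "i \<in> {k<..CARD('n)}" for i
  proof -
    have "d i \<in> set (drop k ?L)" using rest that by blast
    then obtain j where "j < CARD('n) - k" "d i = ?L ! (k + j)"
      by (auto simp: in_set_conv_nth len)
    then show ?thesis
      using eigval_antimono[OF sym, of "Suc k" "Suc (k + j)"] by (simp add: eigval_eq)
  qed
  show "x \<bullet> (N *v x) \<le> eigval N (Suc k) * (x \<bullet> x)" if x: "x \<in> (span (u ` {1..k}))\<^sup>\<bottom>"
  proof -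
    have x0: "x \<bullet> u' i = 0" if "i \<in> {1..k}" for i
      using x that eq(2)[OF that]
      by (auto simp: orthogonal_comp_def orthogonal_def inner_commute span_base)
    have xs: "x \<in> span (u' ` {1..CARD('n)})" by (simp only: orthonormal_eigvecs_span_UNIV[OF u'] UNIV_I)
    show ?thesis
      unfolding orthonormal_eigvecs_quadratic_form[OF u' xs] sum_distrib_left
    proof (rule sum_mono)
      fix i assume "i \<in> {1..CARD('n)}"
      then show "d i * (x \<bullet> u' i)\<^sup>2 \<le> eigval N (Suc k) * (x \<bullet> u' i)\<^sup>2"
        using x0[of i] le[of i] by (cases "i \<le> k") (auto intro: mult_right_mono)
    qed
  qed
  have "eigval N (Suc k) \<in> set (drop k ?L)"
    using k len by (auto simp: eigval_eq in_set_conv_nth intro!: exI[of _ 0])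
  \<comment> \<open>The extension is not sorted beyond \<open>k\<close>, so the index
    \<open>i\<close> carrying this eigenvalue may differ from \<open>Suc k\<close>.\<close>
  then obtain i where i: "i \<in> {k<..CARD('n)}" "d i = eigval N (Suc k)"
    using rest by (metis imageE)
  have "top_eigenvectors N (Suc k) (u(Suc k := u' i))"
  proof -
    have "u' i \<bullet> u' i = 1" "N *v u' i = eigval N (Suc k) *\<^sub>R u' i"
      using u' i by (auto simp: orthonormal_eigvecs_def)
    moreover have "u' i \<bullet> u j = 0" "u j \<bullet> u' i = 0" if "j \<in> {1..k}" for j
      using u' i that eq(2)[OF that, symmetric] k by (auto simp: orthonormal_eigvecs_def)
    ultimately show ?thesis
      using u by (auto simp: top_eigenvectors_def atLeastAtMostSuc_conv)
  qed
  then show "\<exists>w. top_eigenvectors N (Suc k) (u(Suc k := w))" ..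
qed

lemma top_eigenvectors_span:
  fixes N :: "real^'n^'n"
  assumes sym: "symmetric_mat N" and u: "top_eigenvectors N k u" and k: "k \<le> CARD('n)"
    and x: "x \<in> span (u ` {1..k})"
  shows "eigval N k * (x \<bullet> x) \<le> x \<bullet> (N *v x)"
  unfolding orthonormal_eigvecs_quadratic_form[OF u[unfolded top_eigenvectors_iff] x] sum_distrib_left
  using eigval_antimono[OF sym] k by (intro sum_mono mult_right_mono) auto

lemma top_eigenvectors_exist:
  fixes N :: "real^'n^'n"
  assumes sym: "symmetric_mat N"
  shows "k \<le> CARD('n) \<Longrightarrow> \<exists>u. top_eigenvectors N k u"
proof (induction k)
  case 0
  then show ?case by (simp add: top_eigenvectors_def)
next
  case (Suc k)
  then show ?case using top_eigenvectors_complement(2)[OF sym, of k] by (metis Suc_le_eq less_imp_le)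
qed

section \<open>The spectral norm and Weyl's inequality\<close>

lemma spectral_norm_bound: "norm (E *v x) \<le> spectral_norm E * norm x"
  unfolding spectral_norm_def by (intro onorm matrix_vector_mul_bounded_linear)

lemma spectral_norm_nonneg: "0 \<le> spectral_norm E"
  unfolding spectral_norm_def by (intro onorm_pos_le matrix_vector_mul_bounded_linear)

lemma spectral_norm_uminus: "spectral_norm (- E) = spectral_norm E"
proof -
  have "(- E) *v x = - (E *v x)" for x
    using matrix_vector_mult_diff_rdistrib[of 0 E x] by simp
  then show ?thesis by (simp add: spectral_norm_def onorm_neg)
qed

lemma inner_spectral_norm_bound: "\<bar>x \<bullet> (E *v y)\<bar> \<le> spectral_norm E * norm x * norm y"
proof -
  have "\<bar>x \<bullet> (E *v y)\<bar> \<le> norm x * norm (E *v y)" by (rule Cauchy_Schwarz_ineq2)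
  also have "\<dots> \<le> norm x * (spectral_norm E * norm y)"
    by (intro mult_left_mono spectral_norm_bound) simp
  finally show ?thesis by (simp add: ac_simps)
qed

text \<open>Courant-Fischer argument: the top \<open>i\<close> eigenspace of \<open>A\<close> and
  the complement of the top \<open>i - 1\<close> eigenspace of \<open>B\<close> have dimensions
  adding up to \<open>CARD('n) + 1\<close>, so they share a nonzero vector. Its quadratic forms
  under \<open>A\<close> and \<open>B\<close> are compared.\<close>

lemma Weyl_inequality:
  fixes A B :: "real^'n^'n"
  assumes symA: "symmetric_mat A" and symB: "symmetric_mat B" and i: "1 \<le> i" "i \<le> CARD('n)"
  shows "eigval A i \<le> eigval B i + spectral_norm (A - B)"
proof -
  obtain k where k: "i = Suc k" "k < CARD('n)" using i by (cases i) auto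
  obtain u where u: "top_eigenvectors A i u" using top_eigenvectors_exist[OF symA i(2)] ..
  obtain v where v: "top_eigenvectors B k v" using top_eigenvectors_exist[OF symB, of k] k by auto
  let ?U = "span (u ` {1..i})" and ?W = "(span (v ` {1..k}))\<^sup>\<bottom>"
  have dimU: "dim ?U = i" and dimV: "dim (span (v ` {1..k})) = k"
    using orthonormal_eigvecs_dim u v unfolding top_eigenvectors_iff by blast+
  have "dim ?W + k = CARD('n)"
    using dim_subspace_orthogonal_to_vectors[of "span (v ` {1..k})" UNIV] dimV
    by (simp add: orthogonal_comp_def orthogonal_commute)
  moreover have "dim {x + y |x y. x \<in> ?U \<and> y \<in> ?W} + dim (?U \<inter> ?W) = dim ?U + dim ?W"
    by (rule dim_sums_Int) (auto simp: subspace_orthogonal_comp)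
  moreover have "dim {x + y |x y. x \<in> ?U \<and> y \<in> ?W} \<le> CARD('n)"
    using dim_subset_UNIV[of "{x + y |x y. x \<in> ?U \<and> y \<in> ?W}"] by simp
  ultimately have "dim (?U \<inter> ?W) \<noteq> 0" using dimU k by linarith
  then obtain x where x: "x \<in> ?U" "x \<in> ?W" "x \<noteq> 0" by (auto simp: dim_eq_0)
  have "eigval A i * (x \<bullet> x) \<le> x \<bullet> (A *v x)"
    by (rule top_eigenvectors_span[OF symA u i(2) x(1)])
  also have "\<dots> = x \<bullet> (B *v x) + x \<bullet> ((A - B) *v x)"
    by (simp add: matrix_vector_mult_diff_rdistrib inner_diff_right)
  also have "\<dots> \<le> eigval B i * (x \<bullet> x) + spectral_norm (A - B) * (x \<bullet> x)"
    using top_eigenvectors_complement(1)[OF symB v k(2) x(2)] k(1)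
      inner_spectral_norm_bound[of x "A - B" x]
    by (simp add: dot_square_norm power2_eq_square mult.assoc)
  finally have "eigval A i * (x \<bullet> x) \<le> (eigval B i + spectral_norm (A - B)) * (x \<bullet> x)"
    by (simp add: distrib_right)
  then show ?thesis using x(3) by simp
qed

section \<open>The sin theta theorem\<close>

text \<open>On the unit sphere of \<open>W\<close>, the product with \<open>x\<close> reaches the
  norm of the projection \<open>p\<close> of \<open>x\<close> onto \<open>W\<close>. Hence the
  maximiser \<open>y\<close> attains equality in Cauchy-Schwarz with \<open>p\<close>, so
  \<open>p\<close> is \<open>(x \<bullet> y)\<close> times \<open>y\<close>.\<close>

lemma orthogonal_maximiser:
  fixes x y :: "'a::euclidean_space"
  assumes W: "subspace W" and y: "y \<in> W" "norm y = 1"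
    and max: "\<And>z. z \<in> W \<Longrightarrow> norm z = 1 \<Longrightarrow> x \<bullet> z \<le> x \<bullet> y"
    and w: "w \<in> W"
  shows "x \<bullet> w = (x \<bullet> y) * (y \<bullet> w)"
proof -
  let ?s = "x \<bullet> y"
  obtain p q where p: "p \<in> W" and q: "\<And>z. z \<in> W \<Longrightarrow> orthogonal q z" and x: "x = p + q"
    using orthogonal_subspace_decomp_exists[of W x] W by (metis span_eq_iff)
  have xp: "x \<bullet> z = p \<bullet> z" if "z \<in> W" for z
    using q[OF that] by (simp add: x inner_add_left orthogonal_def)
  have "norm p \<le> ?s"
  proof (cases "p = 0")
    case True
    have "0 \<le> ?s" using max[of "- y"] y W by (simp add: subspace_neg)
    then show ?thesis using True by simp
  next
    case False
    then have "x \<bullet> ((1 / norm p) *\<^sub>R p) \<le> ?s"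
      using p W by (intro max) (auto simp: subspace_scale)
    then show ?thesis using False xp[OF p] by (simp add: dot_square_norm power2_eq_square)
  qed
  \<comment> \<open>Since \<open>p \<bullet> y = ?s\<close>, the square expands to a difference that
    the bound \<open>norm p \<le> ?s\<close> makes nonpositive.\<close>
  moreover have "(norm (p - ?s *\<^sub>R y))\<^sup>2 = (norm p)\<^sup>2 - ?s\<^sup>2"
    using y xp[OF y(1)] unfolding power2_norm_eq_inner
    by (simp add: inner_diff_left inner_diff_right norm_eq_1 inner_commute power2_eq_square)
  moreover have "0 \<le> (norm (p - ?s *\<^sub>R y))\<^sup>2" by simp
  ultimately have "(norm (p - ?s *\<^sub>R y))\<^sup>2 = 0"
    by (smt (verit) norm_ge_zero power_mono)
  then have "p = ?s *\<^sub>R y" by simp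
  then show ?thesis using xp[OF w] by simp
qed

text \<open>The spectra enter only through quadratic form bounds on invariant subspaces, so the
  lemma serves both orders of the two matrices.\<close>

lemma sin_theta_bound:
  fixes A B :: "real^'n^'n"
  assumes symB: "symmetric_mat B"
    and U: "subspace U" "\<And>x. x \<in> U \<Longrightarrow> A *v x \<in> U"
      "\<And>x. x \<in> U \<Longrightarrow> a * (x \<bullet> x) \<le> x \<bullet> (A *v x)"
    and W: "subspace W" "\<And>y. y \<in> W \<Longrightarrow> B *v y \<in> W"
      "\<And>y. y \<in> W \<Longrightarrow> y \<bullet> (B *v y) \<le> b * (y \<bullet> y)"
    and ab: "b < a" and x: "x \<in> U" and y: "y \<in> W"
  shows "x \<bullet> y \<le> spectral_norm (A - B) / (a - b) * norm x * norm y"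
proof (cases "x = 0 \<or> y = 0")
  case False
  let ?K = "(U \<inter> sphere 0 1) \<times> (W \<inter> sphere 0 1)"
  let ?n = "\<lambda>z. (1 / norm z) *\<^sub>R z"
  have mem: "(?n x, ?n y) \<in> ?K" using x y U(1) W(1) False by (auto simp: subspace_scale)
  have "compact ?K"
    using closed_subspace[OF U(1)] closed_subspace[OF W(1)]
    by (intro compact_Times) (simp_all add: closed_Int_compact)
  moreover have "continuous_on ?K (\<lambda>z. fst z \<bullet> snd z)" by (intro continuous_intros)
  ultimately obtain z where z: "z \<in> ?K" "\<And>z'. z' \<in> ?K \<Longrightarrow> fst z' \<bullet> snd z' \<le> fst z \<bullet> snd z"
    using continuous_attains_sup[of ?K "\<lambda>z. fst z \<bullet> snd z"] mem by blast
  obtain p q where pq: "z = (p, q)" by (cases z)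
  have p: "p \<in> U" "norm p = 1" and q: "q \<in> W" "norm q = 1" using z(1) by (auto simp: pq)
  let ?s = "p \<bullet> q"
  have max: "p' \<bullet> q' \<le> ?s" if "p' \<in> U" "norm p' = 1" "q' \<in> W" "norm q' = 1" for p' q'
    using z(2)[of "(p', q')"] that by (simp add: pq)
  \<comment> \<open>Flipping the sign of \<open>p\<close> shows nonnegativity, which the
    multiplications by \<open>?s\<close> below rely on.\<close>
  have s0: "0 \<le> ?s" using max[of "- p" q] p q U(1) by (simp add: subspace_neg)
  \<comment> \<open>As \<open>B *v q\<close> stays in \<open>W\<close>, only the component of
    \<open>p\<close> in \<open>W\<close> counts, and that is \<open>?s\<close> times
    \<open>q\<close>.\<close>
  have "p \<bullet> (B *v q) = ?s * (q \<bullet> (B *v q))"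
    using q p W(2) by (intro orthogonal_maximiser[OF W(1)] max) auto
  also have "\<dots> \<le> ?s * b" using W(3)[OF q(1)] q s0 by (intro mult_left_mono) (auto simp: norm_eq_1)
  finally have 1: "p \<bullet> (B *v q) \<le> ?s * b" .
  have "?s * a \<le> ?s * (p \<bullet> (A *v p))"
    using U(3)[OF p(1)] p s0 by (intro mult_left_mono) (auto simp: norm_eq_1)
  also have "\<dots> = q \<bullet> (A *v p)"
    using orthogonal_maximiser[OF U(1) p, of q "A *v p"] max q p U(2)
    by (simp add: inner_commute)
  finally have 2: "?s * a \<le> q \<bullet> (A *v p)" .
  have "q \<bullet> ((A - B) *v p) \<le> spectral_norm (A - B)"
    using inner_spectral_norm_bound[of q "A - B" p] p q by simp
  moreover have "q \<bullet> (B *v p) = p \<bullet> (B *v q)"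
    using symmetric_mat_inner[OF symB, of q p] by (simp add: inner_commute)
  ultimately have "?s * (a - b) \<le> spectral_norm (A - B)"
    using 1 2 by (simp add: matrix_vector_mult_diff_rdistrib inner_diff_right algebra_simps)
  then have "?s \<le> spectral_norm (A - B) / (a - b)" using ab by (simp add: le_divide_eq)
  moreover have "?n x \<bullet> ?n y \<le> ?s" using z(2)[OF mem] by (simp add: pq)
  ultimately have "?n x \<bullet> ?n y \<le> spectral_norm (A - B) / (a - b)" by linarith
  then show ?thesis using False by (simp add: divide_le_eq ac_simps)
qed auto

lemma top_eigenspace_separation:
  fixes A B :: "real^'n^'n"
  assumes symA: "symmetric_mat A" and symB: "symmetric_mat B" and k: "k < CARD('n)"
    and u: "top_eigenvectors A k u" and v: "top_eigenvectors B k v"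
    and g: "0 < g" "g \<le> eigval A k - eigval B (Suc k)"
    and x: "x \<in> span (u ` {1..k})" and y: "y \<in> (span (v ` {1..k}))\<^sup>\<bottom>"
  shows "x \<bullet> y \<le> spectral_norm (A - B) / g * norm x * norm y"
proof -
  note inv = orthonormal_eigvecs_span_invariant[OF u[unfolded top_eigenvectors_iff]]
    orthonormal_eigvecs_span_invariant[OF v[unfolded top_eigenvectors_iff]]
  have "x \<bullet> y \<le> spectral_norm (A - B) / (eigval A k - eigval B (Suc k)) * norm x * norm y"
    using g x y k inv
    by (intro sin_theta_bound[OF symB subspace_span _ _ subspace_orthogonal_comp]
        top_eigenvectors_span[OF symA u] top_eigenvectors_complement(1)[OF symB v]
        symmetric_mat_orthogonal_comp_invariant[OF symB]) auto
  \<comment> \<open>Replacing the actual gap by its lower bound \<open>g\<close> only enlarges the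
    quotient.\<close>
  also have "\<dots> \<le> spectral_norm (A - B) / g * norm x * norm y"
    using g by (intro mult_right_mono divide_left_mono spectral_norm_nonneg) auto
  finally show ?thesis .
qed

section \<open>Differences of projectors and the final bound\<close>

text \<open>With \<open>x = p + p'\<close> split along \<open>U\<close> and its complement,
  \<open>(P - Q) x\<close> equals \<open>(p - Q p) - Q p'\<close>. Each piece is controlled by one
  of the two cross bounds, and the pieces are orthogonal, so Pythagoras yields \<open>s\<close>
  where the triangle inequality would give a larger constant.\<close>

lemma spectral_norm_projector_diff:
  fixes P Q :: "real^'n^'n"
  assumes P: "orthogonal_projector P U" and Q: "orthogonal_projector Q V"
    and s: "0 \<le> s"
    and UV: "\<And>x y. x \<in> U \<Longrightarrow> y \<in> V\<^sup>\<bottom> \<Longrightarrow> x \<bullet> y \<le> s * norm x * norm y"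
    and VU: "\<And>x y. x \<in> V \<Longrightarrow> y \<in> U\<^sup>\<bottom> \<Longrightarrow> x \<bullet> y \<le> s * norm x * norm y"
  shows "spectral_norm (P - Q) \<le> s"
  unfolding spectral_norm_def
proof (rule onorm_bound[OF s])
  fix x
  have inU: "P *v z \<in> U" "z - P *v z \<in> U\<^sup>\<bottom>" and inV: "Q *v z \<in> V" "z - Q *v z \<in> V\<^sup>\<bottom>" for z
    using P Q by (auto simp: orthogonal_projector_def)
  have orthU: "a \<bullet> b = 0" if "a \<in> U" "b \<in> U\<^sup>\<bottom>" for a b
    using that by (auto simp: orthogonal_comp_def orthogonal_def)
  have orthV: "a \<bullet> b = 0" if "a \<in> V" "b \<in> V\<^sup>\<bottom>" for a b
    using that by (auto simp: orthogonal_comp_def orthogonal_def)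
  define p p' where "p = P *v x" and "p' = x - p"
  define c d where "c = p - Q *v p" and "d = Q *v p'"
  have x: "x = p + p'" by (simp add: p'_def)
  have diff: "(P - Q) *v x = c - d"
    by (simp add: c_def d_def p'_def p_def matrix_vector_mult_diff_rdistrib
        matrix_vector_mult_diff_distrib)
  \<comment> \<open>\<open>Q *v p\<close> lies in \<open>V\<close> and \<open>c\<close> in its
    complement, so one factor \<open>c\<close> may be replaced by \<open>p\<close>, to which
    \<open>UV\<close> applies.\<close>
  have "c \<bullet> c = p \<bullet> c"
    using orthV[OF inV(1)[of p] inV(2)[of p]] by (simp add: c_def inner_diff_left)
  also have "\<dots> \<le> s * norm p * norm c"
    using inU(1)[of x] inV(2)[of p] by (intro UV) (auto simp: p_def c_def)
  finally have c: "norm c \<le> s * norm p"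
    using s by (cases "c = 0") (auto simp: dot_square_norm power2_eq_square)
  have "d \<bullet> d = d \<bullet> p'"
    using orthV[OF inV(1)[of p'] inV(2)[of p']] by (simp add: d_def inner_diff_right)
  also have "\<dots> \<le> s * norm d * norm p'"
    using inU(2)[of x] inV(1)[of p'] by (intro VU) (auto simp: p_def p'_def d_def)
  finally have d: "norm d \<le> s * norm p'"
    using s by (cases "d = 0") (auto simp: dot_square_norm power2_eq_square)
  have "d \<bullet> c = 0" using orthV inV by (simp add: c_def d_def)
  then have "(norm ((P - Q) *v x))\<^sup>2 = (norm c)\<^sup>2 + (norm d)\<^sup>2"
    by (simp add: diff power2_norm_eq_inner inner_diff_left inner_diff_right inner_commute)
  also have "\<dots> \<le> (s * norm p)\<^sup>2 + (s * norm p')\<^sup>2"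
    using c d by (intro add_mono power_mono) auto
  also have "\<dots> = s\<^sup>2 * ((norm p)\<^sup>2 + (norm p')\<^sup>2)" by (simp add: power_mult_distrib distrib_left)
  also have "(norm p)\<^sup>2 + (norm p')\<^sup>2 = (norm x)\<^sup>2"
    using orthU[OF inU(1)[of x] inU(2)[of x]] unfolding x power2_norm_eq_inner
    by (simp add: inner_add_left inner_add_right inner_commute p_def p'_def inner_diff_right inner_diff_left)
  finally have "(norm ((P - Q) *v x))\<^sup>2 \<le> (s * norm x)\<^sup>2" by (simp add: power_mult_distrib)
  then show "norm ((P - Q) *v x) \<le> s * norm x"
    by (rule power2_le_imp_le) (use s in simp)
qed

theorem corollary3p8:
  fixes M E P_star P_hat :: "real^'n^'n"
    and k :: nat
    and u v :: "nat \<Rightarrow> real^'n"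
    and \<gamma> :: real
  assumes "pos_semidef M"
    and "symmetric_mat (M + E)"
    and "1 \<le> k" and "k < CARD('n)"
    and "top_eigenvectors M k u"
    and "top_eigenvectors (M + E) k v"
    and "orthogonal_projector P_star (span (u ` {1..k}))"
    and "orthogonal_projector P_hat (span (v ` {1..k}))"
    and "\<gamma> = eigval M k - eigval M (k + 1)"
    and "\<gamma> > 0"
  shows "spectral_norm (P_star - P_hat) \<le> 2 * spectral_norm E / \<gamma>"
proof (rule spectral_norm_projector_diff[OF assms(7,8)])
  have symM: "symmetric_mat M" using assms(1) by (simp add: pos_semidef_def)
  note symN = assms(2)
  have norms: "spectral_norm (M - (M + E)) = spectral_norm E"
    "spectral_norm ((M + E) - M) = spectral_norm E"
    by (simp_all add: spectral_norm_uminus)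
  have s: "2 * spectral_norm E / \<gamma> = spectral_norm E / (\<gamma> / 2)" by simp
  show "0 \<le> 2 * spectral_norm E / \<gamma>" using assms(10) spectral_norm_nonneg[of E] by simp
  \<comment> \<open>Here the claimed constant is at least 1, so Cauchy-Schwarz suffices.\<close>
  have large: "x \<bullet> y \<le> 2 * spectral_norm E / \<gamma> * norm x * norm y"
    if "\<gamma> / 2 \<le> spectral_norm E" for x y :: "real^'n"
  proof -
    have "x \<bullet> y \<le> 1 * (norm x * norm y)" using norm_cauchy_schwarz[of x y] by simp
    also have "\<dots> \<le> 2 * spectral_norm E / \<gamma> * (norm x * norm y)"
      using that assms(10) by (intro mult_right_mono) (auto simp: le_divide_eq)
    finally show ?thesis by (simp add: mult.assoc)
  qed
  show "x \<bullet> y \<le> 2 * spectral_norm E / \<gamma> * norm x * norm y"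
    if "x \<in> span (u ` {1..k})" "y \<in> (span (v ` {1..k}))\<^sup>\<bottom>" for x y
  proof (cases "\<gamma> / 2 \<le> spectral_norm E")
    case False
    \<comment> \<open>Weyl at index \<open>k + 1\<close>: the perturbation raises that eigenvalue by
      less than half of the gap.\<close>
    have "\<gamma> / 2 \<le> eigval M k - eigval (M + E) (Suc k)"
      using Weyl_inequality[OF symN symM, of "Suc k"] norms(2) False assms(4,9) by simp
    from top_eigenspace_separation[OF symM symN assms(4,5,6) _ this that]
    show ?thesis using assms(10) unfolding s norms(1) by simp
  qed (rule large)
  show "x \<bullet> y \<le> 2 * spectral_norm E / \<gamma> * norm x * norm y"
    if "x \<in> span (v ` {1..k})" "y \<in> (span (u ` {1..k}))\<^sup>\<bottom>" for x y
  proof (cases "\<gamma> / 2 \<le> spectral_norm E")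
    case False
    \<comment> \<open>With the roles exchanged, Weyl is used at index \<open>k\<close>: the
      perturbation lowers that eigenvalue by less than half of the gap.\<close>
    have "\<gamma> / 2 \<le> eigval (M + E) k - eigval M (Suc k)"
      using Weyl_inequality[OF symM symN, of k] norms(1) False assms(3,4,9) by simp
    from top_eigenspace_separation[OF symN symM assms(4,6,5) _ this that]
    show ?thesis using assms(10) unfolding s norms(2) by simp
  qed (rule large)
qed

end
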